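(* Let $0<p<\infty$, let $\sigma_1,\sigma_2$ be weight functions on $T$, let $\varphi:T\to T$ be a self map and $\psi:T\to\mathbb{C}$ a function, and suppose that $W_{\psi,\varphi}(f)=\psi\,(f\circ\varphi)$ maps $\mathbb{T}_{\sigma_1,p}$ into $\mathbb{T}_{\sigma_2,\infty}$. Then the operator $W_{\psi,\varphi}:\mathbb{T}_{\sigma_1,p}\to\mathbb{T}_{\sigma_2,\infty}$ is compact if and only if $$\sup_{x\in\varphi^{-1}(y)}\frac{\sigma_2(x)|\psi(x)|}{\sigma_1(\varphi(x))}\left(c_{|\varphi(x)|}\right)^{1/p}\to0\quad\text{as } |y|\to\infty.$$
   Context: $T$ is an infinite rooted tree, identified with its vertex set; $|x|$ is the edge-counting distance from the root $o$ to the vertex $x$; $c_n$ is the number of vertices $x$ with $|x|=n$, $n\in\mathbb{N}_0=\{0,1,2,\dots\}$. Standing assumptions: every $c_n$ is finite and the sequence $\{c_n\}$ is unbounded. A weight function is a function $\sigma:T\to(0,\infty)$. For a weight $\sigma$, $0<p<\infty$ and $f:T\to\mathbb{C}$, put $M_{\sigma,p}(n,f)=\left(\frac{1}{c_n}\sum_{|x|=n}\sigma(x)^p|f(x)|^p\right)^{1/p}$ and $\|f\|_{\sigma,p}=\sup_{n\in\mathbb{N}_0}M_{\sigma,p}(n,f)$; for $p=\infty$ put $\|f\|_{\sigma,\infty}=\sup_{x\in T}\sigma(x)|f(x)|$. The space $\mathbb{T}_{\sigma,p}$ is the set of all $f:T\to\mathbb{C}$ with $\|f\|_{\sigma,p}<\infty$.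 A linear operator $A:X\to Y$ between such spaces is compact if for every bounded sequence $(f_n)$ in $X$ the sequence $(Af_n)$ has a subsequence converging in $Y$ with respect to $\|\cdot\|_Y$. Convention: the supremum of a nonnegative quantity over the empty set is $0$. *)

theory Defs
  imports Complex_Main "HOL-Library.Extended_Nonnegative_Real"
begin

text \<open>
  A graph is given by its adjacency relation on the type of vertices, so the vertex set of the
  tree is the whole type. The notion \<open>tree\<close> from the AFP is not used: it is meant for oriented
  arcs, and in a symmetric digraph every edge already counts there as a cycle of length two.
\<close>

definition graph_cycle :: "('v \<Rightarrow> 'v \<Rightarrow> bool) \<Rightarrow> 'v list \<Rightarrow> bool" where
  "graph_cycle E xs \<longleftrightarrow>
     3 \<le> length xs \<and> distinct xs \<and> successively E xs \<and> E (last xs) (hd xs)"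

definition is_tree :: "('v \<Rightarrow> 'v \<Rightarrow> bool) \<Rightarrow> bool" where
  "is_tree E \<longleftrightarrow>
     symp E \<and> irreflp E \<and> (\<forall>x y. E\<^sup>*\<^sup>* x y) \<and> (\<nexists>xs. graph_cycle E xs)"

text \<open>The relational power \<open>(E ^^ n) r x\<close> says that there is a walk with \<open>n\<close> edges from \<open>r\<close> to \<open>x\<close>.\<close>

definition depth :: "('v \<Rightarrow> 'v \<Rightarrow> bool) \<Rightarrow> 'v \<Rightarrow> 'v \<Rightarrow> nat" where
  "depth E r x = (LEAST n. (E ^^ n) r x)"

definition level :: "('v \<Rightarrow> 'v \<Rightarrow> bool) \<Rightarrow> 'v \<Rightarrow> nat \<Rightarrow> 'v set" where
  "level E r n = {x. depth E r x = n}"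

definition level_size :: "('v \<Rightarrow> 'v \<Rightarrow> bool) \<Rightarrow> 'v \<Rightarrow> nat \<Rightarrow> nat" where
  "level_size E r n = card (level E r n)"

definition weight :: "('v \<Rightarrow> real) \<Rightarrow> bool" where
  "weight \<sigma> \<longleftrightarrow> (\<forall>x. \<sigma> x > 0)"

definition level_mean ::
  "('v \<Rightarrow> 'v \<Rightarrow> bool) \<Rightarrow> 'v \<Rightarrow> ('v \<Rightarrow> real) \<Rightarrow> real \<Rightarrow> nat \<Rightarrow> ('v \<Rightarrow> complex) \<Rightarrow> real" where
  "level_mean E r \<sigma> p n f =
     (1 / real (level_size E r n) * (\<Sum>x\<in>level E r n. \<sigma> x powr p * cmod (f x) powr p)) powr (1 / p)"

text \<open>
  Norms take values in \<open>[0, \<infinity>]\<close>, so that they are defined for every function on the tree and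
  the spaces consist of the functions of finite norm.
\<close>

definition norm_p ::
  "('v \<Rightarrow> 'v \<Rightarrow> bool) \<Rightarrow> 'v \<Rightarrow> ('v \<Rightarrow> real) \<Rightarrow> real \<Rightarrow> ('v \<Rightarrow> complex) \<Rightarrow> ennreal" where
  "norm_p E r \<sigma> p f = (SUP n. ennreal (level_mean E r \<sigma> p n f))"

definition norm_inf :: "('v \<Rightarrow> real) \<Rightarrow> ('v \<Rightarrow> complex) \<Rightarrow> ennreal" where
  "norm_inf \<sigma> f = (SUP x. ennreal (\<sigma> x * cmod (f x)))"

definition finite_norm_space :: "(('v \<Rightarrow> complex) \<Rightarrow> ennreal) \<Rightarrow> ('v \<Rightarrow> complex) set" where
  "finite_norm_space N = {f. N f < \<infinity>}"

definition weighted_comp ::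
  "('v \<Rightarrow> complex) \<Rightarrow> ('v \<Rightarrow> 'v) \<Rightarrow> ('v \<Rightarrow> complex) \<Rightarrow> ('v \<Rightarrow> complex)" where
  "weighted_comp \<psi> \<phi> f = (\<lambda>x. \<psi> x * f (\<phi> x))"

text \<open>
  Compactness of an operator \<open>A\<close> from \<open>finite_norm_space N\<^sub>1\<close> to \<open>finite_norm_space N\<^sub>2\<close>.
\<close>

definition compact_op ::
  "(('v \<Rightarrow> complex) \<Rightarrow> ennreal) \<Rightarrow> (('v \<Rightarrow> complex) \<Rightarrow> ennreal) \<Rightarrow>
   (('v \<Rightarrow> complex) \<Rightarrow> ('v \<Rightarrow> complex)) \<Rightarrow> bool" where
  "compact_op N\<^sub>1 N\<^sub>2 A \<longleftrightarrow>
     (\<forall>f :: nat \<Rightarrow> 'v \<Rightarrow> complex.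
        (\<forall>n. f n \<in> finite_norm_space N\<^sub>1) \<and> (\<exists>C::real. \<forall>n. N\<^sub>1 (f n) \<le> ennreal C) \<longrightarrow>
        (\<exists>s g. strict_mono (s :: nat \<Rightarrow> nat) \<and> g \<in> finite_norm_space N\<^sub>2 \<and>
               (\<lambda>k. N\<^sub>2 (\<lambda>x. A (f (s k)) x - g x)) \<longlonglongrightarrow> 0))"

end

theory Submission
  imports Defs "HOL-Complex_Analysis.Great_Picard"
begin

text \<open>
  Evaluation at \<open>y\<close> has norm \<open>c\<^bsub>|y|\<^esub> powr (1/p) / \<sigma>\<^sub>1 y\<close> on the space of functions of finite
  norm, attained at a multiple of the indicator function of \<open>y\<close>: the peak function, of norm one.
  If the operator is compact, it sends these peak functions to \<open>0\<close> in norm as \<open>|y| \<rightarrow> \<infinity>\<close>, because they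
  tend to \<open>0\<close> pointwise; the norms of their images are the suprema in question.
  Conversely, a bounded sequence has a pointwise convergent subsequence, by diagonalisation over the
  countable vertex set. Its image converges uniformly: the vertices mapped far from the root are
  controlled by the hypothesis, and those mapped near it lie over finitely many \<open>y\<close>, over each of
  which \<open>\<sigma>\<^sub>2 |\<psi>|\<close> is bounded, since the peak function at \<open>y\<close> has an image of finite norm.
\<close>

section \<open>Point evaluations and peak functions\<close>

definition eval_norm ::
  "('v \<Rightarrow> 'v \<Rightarrow> bool) \<Rightarrow> 'v \<Rightarrow> ('v \<Rightarrow> real) \<Rightarrow> real \<Rightarrow> 'v \<Rightarrow> real" where
  "eval_norm E r \<sigma> p y = real (level_size E r (depth E r y)) powr (1 / p) / \<sigma> y"

definition peak ::
  "('v \<Rightarrow> 'v \<Rightarrow> bool) \<Rightarrow> 'v \<Rightarrow> ('v \<Rightarrow> real) \<Rightarrow> real \<Rightarrow> 'v \<Rightarrow> 'v \<Rightarrow> complex" where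
  "peak E r \<sigma> p y x = (if x = y then of_real (eval_norm E r \<sigma> p y) else 0)"

lemma level_size_depth_pos:
  assumes "finite (level E r (depth E r y))"
  shows "0 < level_size E r (depth E r y)"
  using assms unfolding level_size_def card_gt_0_iff by (auto simp: level_def)

lemma eval_norm_pos:
  assumes "finite (level E r (depth E r y))" and "weight \<sigma>"
  shows "0 < eval_norm E r \<sigma> p y"
  using level_size_depth_pos[OF assms(1)] assms(2) by (simp add: eval_norm_def weight_def)

text \<open>\<open>depth\<close> assigns a number to every vertex, so the finite levels cover the
  whole type. Countability is what the diagonal argument rests on.\<close>

lemma countable_vertices:
  fixes E :: "'v \<Rightarrow> 'v \<Rightarrow> bool"
  assumes "\<And>n. finite (level E r n)"
  shows "countable (UNIV :: 'v set)"
proof -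
  have "(UNIV :: 'v set) = (\<Union>n. level E r n)"
    by (auto simp: level_def)
  then show ?thesis
    using assms by (metis countable_UN countable_finite countableI_type)
qed

lemma finite_depth_less:
  assumes "\<And>n. finite (level E r n)"
  shows "finite {y. depth E r y < N}"
proof -
  have "{y. depth E r y < N} = (\<Union>n<N. level E r n)"
    by (auto simp: level_def)
  then show ?thesis
    using assms by simp
qed

text \<open>Only the level of \<open>y\<close> contributes. Its sum has the single nonzero term
  \<open>(\<sigma> y * eval_norm E r \<sigma> p y) powr p\<close>, which equals the level size, so
  the average there is 1.\<close>

lemma norm_p_peak_le:
  assumes fin: "\<And>n. finite (level E r n)" and "0 < p" and \<sigma>: "weight \<sigma>"
  shows "norm_p E r \<sigma> p (peak E r \<sigma> p y) \<le> 1"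
proof -
  let ?c = "real (level_size E r (depth E r y))"
  have c: "0 < ?c"
    using level_size_depth_pos[OF fin, of y] by simp
  have \<sigma>y: "0 < \<sigma> y"
    using \<sigma> by (simp add: weight_def)
  have term_eq: "\<sigma> x powr p * cmod (peak E r \<sigma> p y x) powr p = (if x = y then ?c else 0)" for x
  proof (cases "x = y")
    case True
    have "\<sigma> y powr p * eval_norm E r \<sigma> p y powr p = (\<sigma> y * eval_norm E r \<sigma> p y) powr p"
      using \<sigma>y eval_norm_pos[OF fin \<sigma>, of p y] by (simp add: powr_mult)
    also have "\<dots> = (?c powr (1 / p)) powr p"
      using \<sigma>y by (simp add: eval_norm_def)
    also have "\<dots> = ?c"
      using c \<open>0 < p\<close> by (simp add: powr_powr)
    finally show ?thesis
      using True eval_norm_pos[OF fin \<sigma>, of p y] by (simp add: peak_def)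
  qed (simp add: peak_def)
  have "level_mean E r \<sigma> p n (peak E r \<sigma> p y) \<le> 1" for n
  proof -
    have "(\<Sum>x\<in>level E r n. \<sigma> x powr p * cmod (peak E r \<sigma> p y x) powr p)
        = (if depth E r y = n then ?c else 0)"
      unfolding term_eq using fin[of n] by (simp add: level_def)
    then show ?thesis
      using c by (auto simp: level_mean_def)
  qed
  then show ?thesis
    unfolding norm_p_def by (intro SUP_least) simp
qed

text \<open>The sum over the level of \<open>y\<close> is at least its term at \<open>y\<close>;
  solving for \<open>cmod (f y)\<close> gives the bound. The sign of \<open>C\<close> matters
  because \<open>ennreal\<close> sends negative reals to 0.\<close>

lemma norm_p_eval_bound:
  assumes fin: "\<And>n. finite (level E r n)" and "0 < p" and \<sigma>: "weight \<sigma>"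
    and C: "norm_p E r \<sigma> p f \<le> ennreal C" "0 \<le> C"
  shows "cmod (f y) \<le> C * eval_norm E r \<sigma> p y"
proof -
  let ?n = "depth E r y"
  let ?c = "real (level_size E r ?n)"
  let ?S = "\<Sum>x\<in>level E r ?n. \<sigma> x powr p * cmod (f x) powr p"
  have c: "0 < ?c"
    using level_size_depth_pos[OF fin, of y] by simp
  have \<sigma>y: "0 < \<sigma> y"
    using \<sigma> by (simp add: weight_def)
  have "ennreal (level_mean E r \<sigma> p ?n f) \<le> ennreal C"
    using C(1) unfolding norm_p_def by (meson SUP_upper UNIV_I order_trans)
  then have "(1 / ?c * ?S) powr (1 / p) \<le> C"
    using C(2) by (simp add: level_mean_def)
  moreover have "(\<sigma> y * cmod (f y)) powr p \<le> ?S"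
    using member_le_sum[of y "level E r ?n" "\<lambda>x. \<sigma> x powr p * cmod (f x) powr p"] fin \<sigma>y
    by (simp add: level_def powr_mult)
  then have "(1 / ?c * (\<sigma> y * cmod (f y)) powr p) powr (1 / p) \<le> (1 / ?c * ?S) powr (1 / p)"
    using c \<open>0 < p\<close> by (intro powr_mono2) (auto intro: divide_right_mono)
  moreover have "(1 / ?c * (\<sigma> y * cmod (f y)) powr p) powr (1 / p)
      = \<sigma> y * cmod (f y) / ?c powr (1 / p)"
    using c \<sigma>y \<open>0 < p\<close> by (simp add: powr_divide powr_powr)
  ultimately have "\<sigma> y * cmod (f y) / ?c powr (1 / p) \<le> C"
    by linarith
  then show ?thesis
    using c \<sigma>y by (simp add: eval_norm_def field_simps)
qed

section \<open>Supremum norm, limits in the extended half-line, subsequences\<close>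

lemma norm_inf_le_iff:
  assumes "0 \<le> C"
  shows "norm_inf \<sigma> f \<le> ennreal C \<longleftrightarrow> (\<forall>x. \<sigma> x * cmod (f x) \<le> C)"
  using assms by (simp add: norm_inf_def SUP_le_iff)

lemma finite_norm_infE:
  assumes "f \<in> finite_norm_space (norm_inf \<sigma>)"
  obtains C where "0 \<le> C" "\<And>x. \<sigma> x * cmod (f x) \<le> C"
proof -
  have "norm_inf \<sigma> f < top"
    using assms by (simp add: finite_norm_space_def)
  then obtain C where "norm_inf \<sigma> f = ennreal C" "0 \<le> C"
    by (metis ennreal_cases less_irrefl)
  then show ?thesis
    using that norm_inf_le_iff[of C \<sigma> f] by auto
qed

text \<open>Below every positive \<open>a\<close>, even infinity, density supplies a positive
  element strictly smaller than \<open>a\<close>, hence a real one. The strict gap turns the weak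
  bound of the assumption into the strict one that the order topology asks for.\<close>

lemma ennreal_tendsto_0I:
  fixes f :: "'a \<Rightarrow> ennreal"
  assumes "\<And>e. 0 < e \<Longrightarrow> \<forall>\<^sub>F x in F. f x \<le> ennreal e"
  shows "(f \<longlongrightarrow> 0) F"
proof (rule order_tendstoI)
  fix a :: ennreal
  assume "0 < a"
  then obtain b where "0 < b" "b < a"
    using dense by blast
  then obtain e where "b = ennreal e" "0 < e"
    by (metis ennreal_cases ennreal_less_zero_iff not_top_less top.not_eq_extremum)
  then show "\<forall>\<^sub>F x in F. f x < a"
    using assms[of e] \<open>b < a\<close> by (auto elim: eventually_mono)
qed simp

lemma ennreal_tendsto_0D:
  fixes f :: "'a \<Rightarrow> ennreal"
  assumes "(f \<longlongrightarrow> 0) F" and "0 < e"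
  shows "\<forall>\<^sub>F x in F. f x < ennreal e"
  using order_tendstoD(2)[OF assms(1), of "ennreal e"] assms(2) by simp

text \<open>\<open>function_convergent_subsequence\<close> wants one bound for all points, while
  \<open>B\<close> varies with the point. So the functions are first divided by \<open>B\<close>,
  and the limits are multiplied back.\<close>

lemma pointwise_convergent_subsequence:
  fixes f :: "nat \<Rightarrow> 'v \<Rightarrow> complex" and B :: "'v \<Rightarrow> real"
  assumes "countable (UNIV :: 'v set)" and B: "\<And>y. 0 < B y" and f: "\<And>n y. cmod (f n y) \<le> B y"
  obtains s l where "strict_mono (s :: nat \<Rightarrow> nat)" "\<And>y. (\<lambda>k. f (s k) y) \<longlonglongrightarrow> l y"
proof -
  have "norm (f n y / of_real (B y)) \<le> 1" for n y
    using f[of n y] B[of y] by (simp add: norm_divide)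
  then obtain s where s: "strict_mono (s :: nat \<Rightarrow> nat)"
    and conv: "\<And>y. \<exists>l. (\<lambda>k. f (s k) y / of_real (B y)) \<longlonglongrightarrow> l"
    using function_convergent_subsequence[OF assms(1), of "\<lambda>n y. f n y / of_real (B y)" 1]
    by (metis UNIV_I)
  have "\<exists>l. (\<lambda>k. f (s k) y) \<longlonglongrightarrow> l" for y
  proof -
    obtain l where "(\<lambda>k. f (s k) y / of_real (B y)) \<longlonglongrightarrow> l"
      using conv by blast
    from tendsto_mult_left[OF this, of "of_real (B y)"] show ?thesis
      using B[of y] by auto
  qed
  then show ?thesis
    using that s by metis
qed

section \<open>The two implications for the weighted composition operator\<close>

lemma weighted_comp_peak:
  "weighted_comp \<psi> \<phi> (peak E r \<sigma> p y) x
     = (if \<phi> x = y then \<psi> x * of_real (eval_norm E r \<sigma> p (\<phi> x)) else 0)"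
  by (simp add: weighted_comp_def peak_def)

lemma compact_weighted_comp_imp_tendsto:
  assumes fin: "\<And>n. finite (level E r n)" and "0 < p" and \<sigma>\<^sub>1: "weight \<sigma>\<^sub>1" and \<sigma>\<^sub>2: "weight \<sigma>\<^sub>2"
    and comp: "compact_op (norm_p E r \<sigma>\<^sub>1 p) (norm_inf \<sigma>\<^sub>2) (weighted_comp \<psi> \<phi>)"
  shows "((\<lambda>y. SUP x\<in>\<phi> -` {y}. ennreal (\<sigma>\<^sub>2 x * cmod (\<psi> x) * eval_norm E r \<sigma>\<^sub>1 p (\<phi> x))) \<longlongrightarrow> 0)
    (filtercomap (depth E r) at_top)"
proof (rule ennreal_tendsto_0I, rule ccontr)
  let ?u = "eval_norm E r \<sigma>\<^sub>1 p"
  let ?S = "\<lambda>y. SUP x\<in>\<phi> -` {y}. ennreal (\<sigma>\<^sub>2 x * cmod (\<psi> x) * ?u (\<phi> x))"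
  let ?W = "weighted_comp \<psi> \<phi>"
  fix e :: real
  assume "0 < e" and "\<not> (\<forall>\<^sub>F y in filtercomap (depth E r) at_top. ?S y \<le> ennreal e)"
  then have "\<forall>n. \<exists>y. n \<le> depth E r y \<and> \<not> ?S y \<le> ennreal e"
    by (simp add: eventually_filtercomap_at_top_linorder)
  \<comment> \<open>The vertices \<open>Y n\<close> may repeat, but their depths tend to
    infinity.\<close>
  then obtain Y where Y: "\<And>n. n \<le> depth E r (Y n)" "\<And>n. \<not> ?S (Y n) \<le> ennreal e"
    by metis
  let ?f = "\<lambda>n. peak E r \<sigma>\<^sub>1 p (Y n)"
  have f_le: "norm_p E r \<sigma>\<^sub>1 p (?f n) \<le> ennreal 1" for n
    using norm_p_peak_le[OF fin \<open>0 < p\<close> \<sigma>\<^sub>1] by simp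
  have "?f n \<in> finite_norm_space (norm_p E r \<sigma>\<^sub>1 p)" for n
    using le_less_trans[OF f_le] by (simp add: finite_norm_space_def)
  then have "\<exists>s g. strict_mono (s :: nat \<Rightarrow> nat) \<and> g \<in> finite_norm_space (norm_inf \<sigma>\<^sub>2) \<and>
      (\<lambda>k. norm_inf \<sigma>\<^sub>2 (\<lambda>x. ?W (?f (s k)) x - g x)) \<longlonglongrightarrow> 0"
    using f_le by (intro comp[unfolded compact_op_def, rule_format, of ?f]) blast
  then obtain s g where s: "strict_mono (s :: nat \<Rightarrow> nat)"
    and lim: "(\<lambda>k. norm_inf \<sigma>\<^sub>2 (\<lambda>x. ?W (?f (s k)) x - g x)) \<longlonglongrightarrow> 0"
    by blast
  have s_ge: "k \<le> s k" for k
    using s by (rule strict_mono_imp_increasing)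
  \<comment> \<open>At a fixed \<open>x\<close> the image of \<open>?f (s k)\<close> vanishes for
    late \<open>k\<close>, so \<open>\<sigma>\<^sub>2 x * cmod (g x)\<close> is bounded by norms
    that tend to 0.\<close>
  have g0: "g x = 0" for x
  proof (rule ccontr)
    assume "g x \<noteq> 0"
    then have pos: "0 < \<sigma>\<^sub>2 x * cmod (g x)"
      using \<sigma>\<^sub>2 by (simp add: weight_def)
    obtain K where K: "\<And>k. K \<le> k \<Longrightarrow>
        norm_inf \<sigma>\<^sub>2 (\<lambda>x. ?W (?f (s k)) x - g x) < ennreal (\<sigma>\<^sub>2 x * cmod (g x))"
      using ennreal_tendsto_0D[OF lim pos] unfolding eventually_sequentially by blast
    \<comment> \<open>\<open>K\<close> makes the norm small; the successor puts
      \<open>Y (s k)\<close> strictly deeper than \<open>\<phi> x\<close>, since its depth is at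
      least \<open>s k\<close>, hence at least \<open>k\<close>.\<close>
    define k where "k = max K (Suc (depth E r (\<phi> x)))"
    have "\<phi> x \<noteq> Y (s k)"
      using Y(1)[of "s k"] s_ge[of k] by (auto simp: k_def)
    then have "?W (?f (s k)) x = 0"
      by (simp add: weighted_comp_peak)
    then have "ennreal (\<sigma>\<^sub>2 x * cmod (g x)) \<le> norm_inf \<sigma>\<^sub>2 (\<lambda>x. ?W (?f (s k)) x - g x)"
      unfolding norm_inf_def by (intro SUP_upper2[of x]) auto
    with K[of k] show False
      by (simp add: k_def)
  qed
  \<comment> \<open>On the fibre over \<open>Y n\<close> the weighted modulus of the image of the
    peak is the quantity under the supremum. Along \<open>s\<close> the norm of this image falls
    below \<open>e\<close>, against the choice of \<open>Y\<close>.\<close>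
  have "?S (Y n) \<le> norm_inf \<sigma>\<^sub>2 (?W (?f n))" for n
    unfolding norm_inf_def
  proof (rule SUP_mono)
    fix x
    assume "x \<in> \<phi> -` {Y n}"
    then have "\<sigma>\<^sub>2 x * cmod (\<psi> x) * ?u (\<phi> x) = \<sigma>\<^sub>2 x * cmod (?W (?f n) x)"
      using eval_norm_pos[OF fin \<sigma>\<^sub>1, of p "Y n"] by (simp add: weighted_comp_peak norm_mult)
    then show "\<exists>z\<in>UNIV. ennreal (\<sigma>\<^sub>2 x * cmod (\<psi> x) * ?u (\<phi> x)) \<le> ennreal (\<sigma>\<^sub>2 z * cmod (?W (?f n) z))"
      by (intro bexI[of _ x]) (simp_all only: order_refl UNIV_I)
  qed
  moreover have "\<exists>k. norm_inf \<sigma>\<^sub>2 (?W (?f (s k))) < ennreal e"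
    using ennreal_tendsto_0D[OF lim \<open>0 < e\<close>] by (auto simp: g0 eventually_sequentially)
  ultimately show False
    using Y(2) by (meson le_less_trans less_imp_le)
qed

lemma tendsto_imp_compact_weighted_comp:
  fixes E :: "'v \<Rightarrow> 'v \<Rightarrow> bool"
  assumes fin: "\<And>n. finite (level E r n)" and "0 < p" and \<sigma>\<^sub>1: "weight \<sigma>\<^sub>1" and \<sigma>\<^sub>2: "weight \<sigma>\<^sub>2"
    and maps: "weighted_comp \<psi> \<phi> ` finite_norm_space (norm_p E r \<sigma>\<^sub>1 p)
      \<subseteq> finite_norm_space (norm_inf \<sigma>\<^sub>2)"
    and lim: "((\<lambda>y. SUP x\<in>\<phi> -` {y}. ennreal (\<sigma>\<^sub>2 x * cmod (\<psi> x) * eval_norm E r \<sigma>\<^sub>1 p (\<phi> x))) \<longlongrightarrow> 0)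
      (filtercomap (depth E r) at_top)"
  shows "compact_op (norm_p E r \<sigma>\<^sub>1 p) (norm_inf \<sigma>\<^sub>2) (weighted_comp \<psi> \<phi>)"
  unfolding compact_op_def
proof (intro allI impI, elim conjE exE)
  let ?u = "eval_norm E r \<sigma>\<^sub>1 p"
  let ?W = "weighted_comp \<psi> \<phi>"
  fix f :: "nat \<Rightarrow> 'v \<Rightarrow> complex" and C' :: real
  assume f_in: "\<forall>n. f n \<in> finite_norm_space (norm_p E r \<sigma>\<^sub>1 p)"
    and f_le: "\<forall>n. norm_p E r \<sigma>\<^sub>1 p (f n) \<le> ennreal C'"
  \<comment> \<open>\<open>C'\<close> may be zero or negative; the later quotient
    \<open>e / (2 * C)\<close> needs a positive bound.\<close>
  define C where "C = max C' 1"
  have C: "0 < C" and "ennreal C' \<le> ennreal C"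
    by (auto simp: C_def intro: ennreal_leI)
  with f_le have f_le': "norm_p E r \<sigma>\<^sub>1 p (f n) \<le> ennreal C" for n
    by (meson order_trans)
  have u: "0 < ?u y" for y
    using eval_norm_pos[OF fin \<sigma>\<^sub>1] .
  have \<sigma>2: "0 < \<sigma>\<^sub>2 x" for x
    using \<sigma>\<^sub>2 by (simp add: weight_def)
  have f_eval: "cmod (f n y) \<le> C * ?u y" for n y
    using norm_p_eval_bound[OF fin \<open>0 < p\<close> \<sigma>\<^sub>1 f_le'] C by simp
  obtain s l where s: "strict_mono (s :: nat \<Rightarrow> nat)" and l: "\<And>y. (\<lambda>k. f (s k) y) \<longlonglongrightarrow> l y"
    using pointwise_convergent_subsequence[OF countable_vertices[OF fin], of "\<lambda>y. C * ?u y" f]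
      f_eval u C by auto
  have l_eval: "cmod (l y) \<le> C * ?u y" for y
    using f_eval by (intro Lim_norm_ubound[OF _ l]) auto
  \<comment> \<open>The fibre over \<open>y\<close> may be infinite. On it the image of the peak at
    \<open>y\<close> is \<psi> times the positive constant \<open>?u y\<close>, so its finite norm
    bounds \<open>\<sigma>\<^sub>2 x * cmod (\<psi> x)\<close>.\<close>
  have "\<exists>D. \<forall>x\<in>\<phi> -` {y}. \<sigma>\<^sub>2 x * cmod (\<psi> x) \<le> D" for y
  proof -
    have "norm_p E r \<sigma>\<^sub>1 p (peak E r \<sigma>\<^sub>1 p y) < \<infinity>"
      using le_less_trans[OF norm_p_peak_le[OF fin \<open>0 < p\<close> \<sigma>\<^sub>1]] by simp
    then have "?W (peak E r \<sigma>\<^sub>1 p y) \<in> finite_norm_space (norm_inf \<sigma>\<^sub>2)"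
      using maps by (auto simp: finite_norm_space_def)
    then obtain D where D: "\<And>x. \<sigma>\<^sub>2 x * cmod (?W (peak E r \<sigma>\<^sub>1 p y) x) \<le> D"
      by (rule finite_norm_infE) blast
    have "\<sigma>\<^sub>2 x * cmod (\<psi> x) \<le> D / ?u y" if "\<phi> x = y" for x
      using D[of x] that u[of y] by (simp add: weighted_comp_peak norm_mult field_simps)
    then show ?thesis
      by auto
  qed
  then obtain D where D: "\<And>x. \<sigma>\<^sub>2 x * cmod (\<psi> x) \<le> D (\<phi> x)"
    by (metis singletonI vimageI)
  have W_lim: "(\<lambda>k. norm_inf \<sigma>\<^sub>2 (\<lambda>x. ?W (f (s k)) x - ?W l x)) \<longlonglongrightarrow> 0"
  proof (rule ennreal_tendsto_0I)
    fix e :: real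
    assume e: "0 < e"
    \<comment> \<open>Both \<open>f (s k)\<close> and \<open>l\<close> are bounded by
      \<open>C * ?u\<close>, so their difference is bounded by \<open>2 * C * ?u\<close>; with this
      threshold the far vertices contribute at most \<open>e\<close>.\<close>
    then have "0 < e / (2 * C)"
      using C by simp
    from ennreal_tendsto_0D[OF lim this] obtain N where N: "\<And>y. N \<le> depth E r y \<Longrightarrow>
        (SUP x\<in>\<phi> -` {y}. ennreal (\<sigma>\<^sub>2 x * cmod (\<psi> x) * ?u (\<phi> x))) < ennreal (e / (2 * C))"
      by (auto simp: eventually_filtercomap_at_top_linorder)
    have far: "\<sigma>\<^sub>2 x * cmod (\<psi> x) * ?u (\<phi> x) \<le> e / (2 * C)" if "N \<le> depth E r (\<phi> x)" for x
    proof -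
      have "ennreal (\<sigma>\<^sub>2 x * cmod (\<psi> x) * ?u (\<phi> x)) \<le> ennreal (e / (2 * C))"
        by (rule order_trans[OF SUP_upper less_imp_le[OF N[OF that]]]) simp
      then show ?thesis
        using e C by simp
    qed
    \<comment> \<open>The product tends to 0 whatever the sign of \<open>D y\<close>, which is
      arbitrary over an empty fibre. The finitely many \<open>y\<close> of depth below
      \<open>N\<close> then share one threshold for \<open>k\<close>.\<close>
    have "\<forall>\<^sub>F k in sequentially. D y * cmod (f (s k) y - l y) < e" for y
    proof -
      have "(\<lambda>k. D y * cmod (f (s k) y - l y)) \<longlonglongrightarrow> D y * cmod (l y - l y)"
        by (intro tendsto_intros l)
      then show ?thesis
        using order_tendstoD(2) e by fastforce
    qed
    then have "\<forall>\<^sub>F k in sequentially. \<forall>y\<in>{y. depth E r y < N}. D y * cmod (f (s k) y - l y) < e"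
      by (intro eventually_ball_finite finite_depth_less[OF fin]) simp
    then show "\<forall>\<^sub>F k in sequentially. norm_inf \<sigma>\<^sub>2 (\<lambda>x. ?W (f (s k)) x - ?W l x) \<le> ennreal e"
    proof (rule eventually_mono)
      fix k
      assume near: "\<forall>y\<in>{y. depth E r y < N}. D y * cmod (f (s k) y - l y) < e"
      have "\<sigma>\<^sub>2 x * cmod (?W (f (s k)) x - ?W l x) \<le> e" for x
      proof -
        have eq: "\<sigma>\<^sub>2 x * cmod (?W (f (s k)) x - ?W l x)
            = \<sigma>\<^sub>2 x * cmod (\<psi> x) * cmod (f (s k) (\<phi> x) - l (\<phi> x))"
          by (simp add: weighted_comp_def norm_mult flip: right_diff_distrib)
        show ?thesis
        proof (cases "depth E r (\<phi> x) < N")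
          case True
          then show ?thesis
            using near mult_right_mono[OF D[of x], of "cmod (f (s k) (\<phi> x) - l (\<phi> x))"] eq
            by fastforce
        next
          case False
          have "cmod (f (s k) (\<phi> x) - l (\<phi> x)) \<le> 2 * C * ?u (\<phi> x)"
            using norm_triangle_ineq4[of "f (s k) (\<phi> x)" "l (\<phi> x)"]
              f_eval[of "s k" "\<phi> x"] l_eval[of "\<phi> x"] by linarith
          then have "\<sigma>\<^sub>2 x * cmod (\<psi> x) * cmod (f (s k) (\<phi> x) - l (\<phi> x))
              \<le> \<sigma>\<^sub>2 x * cmod (\<psi> x) * (2 * C * ?u (\<phi> x))"
            using \<sigma>2[of x] by (intro mult_left_mono) auto
          also have "\<dots> \<le> e"
            using far[of x] False C by (simp add: field_simps)
          finally show ?thesis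
            by (simp only: eq)
        qed
      qed
      then show "norm_inf \<sigma>\<^sub>2 (\<lambda>x. ?W (f (s k)) x - ?W l x) \<le> ennreal e"
        using e by (simp add: norm_inf_le_iff)
    qed
  qed
  \<comment> \<open>The norm of \<open>l\<close> has not been estimated, so \<open>maps\<close> is
    not applied to it. Instead \<open>?W l\<close> is within distance 1 of some
    \<open>?W (f (s k))\<close>, whose norm is finite by \<open>maps\<close>.\<close>
  have "?W l \<in> finite_norm_space (norm_inf \<sigma>\<^sub>2)"
  proof -
    obtain k where "norm_inf \<sigma>\<^sub>2 (\<lambda>x. ?W (f (s k)) x - ?W l x) < ennreal 1"
      using ennreal_tendsto_0D[OF W_lim zero_less_one] by (auto simp: eventually_sequentially)
    then have k: "\<sigma>\<^sub>2 x * cmod (?W (f (s k)) x - ?W l x) \<le> 1" for x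
      using norm_inf_le_iff[of 1] less_imp_le by fastforce
    have "?W (f (s k)) \<in> finite_norm_space (norm_inf \<sigma>\<^sub>2)"
      using maps f_in by auto
    then obtain B where B: "0 \<le> B" "\<And>x. \<sigma>\<^sub>2 x * cmod (?W (f (s k)) x) \<le> B"
      by (rule finite_norm_infE) blast
    have "\<sigma>\<^sub>2 x * cmod (?W l x) \<le> B + 1" for x
    proof -
      have "cmod (?W l x) \<le> cmod (?W (f (s k)) x) + cmod (?W (f (s k)) x - ?W l x)"
        using norm_triangle_sub[of "?W l x" "?W (f (s k)) x"] by (simp add: norm_minus_commute)
      then have "\<sigma>\<^sub>2 x * cmod (?W l x)
          \<le> \<sigma>\<^sub>2 x * (cmod (?W (f (s k)) x) + cmod (?W (f (s k)) x - ?W l x))"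
        using \<sigma>2[of x] by simp
      then show ?thesis
        using B(2)[of x] k[of x] by (simp add: distrib_left)
    qed
    then have "norm_inf \<sigma>\<^sub>2 (?W l) \<le> ennreal (B + 1)"
      by (subst norm_inf_le_iff) (use B(1) in auto)
    then show ?thesis
      using le_less_trans[OF _ ennreal_less_top] by (simp add: finite_norm_space_def)
  qed
  with s W_lim show "\<exists>s g. strict_mono (s :: nat \<Rightarrow> nat) \<and> g \<in> finite_norm_space (norm_inf \<sigma>\<^sub>2) \<and>
      (\<lambda>k. norm_inf \<sigma>\<^sub>2 (\<lambda>x. ?W (f (s k)) x - g x)) \<longlonglongrightarrow> 0"
    by blast
qed

theorem theorem10:
  fixes E :: "'v \<Rightarrow> 'v \<Rightarrow> bool" and r :: 'v
    and \<sigma>\<^sub>1 \<sigma>\<^sub>2 :: "'v \<Rightarrow> real" and p :: real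
    and \<phi> :: "'v \<Rightarrow> 'v" and \<psi> :: "'v \<Rightarrow> complex"
  assumes "is_tree E" and "infinite (UNIV :: 'v set)"
    and "\<And>n. finite (level E r n)"
    and "\<not> bdd_above (range (level_size E r))"
    and "0 < p"
    and "weight \<sigma>\<^sub>1" and "weight \<sigma>\<^sub>2"
    and "weighted_comp \<psi> \<phi> ` finite_norm_space (norm_p E r \<sigma>\<^sub>1 p)
           \<subseteq> finite_norm_space (norm_inf \<sigma>\<^sub>2)"
  shows "compact_op (norm_p E r \<sigma>\<^sub>1 p) (norm_inf \<sigma>\<^sub>2) (weighted_comp \<psi> \<phi>) \<longleftrightarrow>
    ((\<lambda>y. SUP x\<in>\<phi> -` {y}. ennreal (\<sigma>\<^sub>2 x * cmod (\<psi> x) / \<sigma>\<^sub>1 (\<phi> x) *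
           real (level_size E r (depth E r (\<phi> x))) powr (1 / p))) \<longlongrightarrow> 0)
      (filtercomap (depth E r) at_top)"
proof -
  \<comment> \<open>Regrouping exposes the norm of the evaluation at \<open>\<phi> x\<close>, the
    form in which both implications are stated.\<close>
  have ratio_eq: "\<sigma>\<^sub>2 x * cmod (\<psi> x) / \<sigma>\<^sub>1 (\<phi> x) * real (level_size E r (depth E r (\<phi> x))) powr (1 / p)
      = \<sigma>\<^sub>2 x * cmod (\<psi> x) * eval_norm E r \<sigma>\<^sub>1 p (\<phi> x)" for x
    by (simp add: eval_norm_def)
  show ?thesis
    unfolding ratio_eq
    using compact_weighted_comp_imp_tendsto[OF assms(3,5,6,7)]
      tendsto_imp_compact_weighted_comp[OF assms(3,5,6,7,8)] by (rule iffI)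
qed

end
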